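(* Let $E$ be a sequentially ordered sequential effect algebra and let $b\in E$ with $b\ne 0$. (i) There exists a unique sequential product $\circ_b$ on the effect algebra $[0,b]$ such that $(a\circ_b c)/b=(a/b)\circ(c/b)$ for all $a,c\in[0,b]$. (ii) When $[0,b]$ is equipped with this sequential product (and $[0,\widehat{b}]$ with the restriction of $\circ$), the map $\phi_b\colon[0,b]\to[0,\widehat{b}]$, $\phi_b(a)=a/b$, is an isomorphism of sequential effect algebras.
   Context: An effect algebra is a system $(E,0,1,\oplus)$ where $0\neq 1\in E$ and $\oplus$ is a partial binary operation on $E$ such that: (A1) if $a\oplus b$ is defined then $b\oplus a$ is defined and $b\oplus a=a\oplus b$; (A2) if $a\oplus b$ and $(a\oplus b)\oplus c$ are defined, then $b\oplus c$ and $a\oplus(b\oplus c)$ are defined and $a\oplus(b\oplus c)=(a\oplus b)\oplus c$; (A3) for every $a\in E$ there is a unique $a'\in E$ with $a\oplus a'=1$; (A4) if $a\oplus 1$ is defined then $a=0$. Write $a\perp b$ if $a\oplus b$ is defined, and $a\le b$ if $a\oplus c=b$ for some $c$ (a partial order). For a binary operation $\circ$ write $a\mid b$ if $a\circ b=b\circ a$. A sequential product on $E$ is a binary operation $\circ\colon E\times E\to E$ such that: (S1) if $b\perp c$ then $a\circ b\perp a\circ c$ and $a\circ(b\oplus c)=a\circ b\oplus a\circ c$; (S2) $1\circ a=a$ for all $a$; (S3) if $a\circ b=0$ then $a\mid b$; (S4) if $a\mid b$ then $a\mid b'$ and $a\circ(b\circ c)=(a\circ b)\circ c$ for all $c$;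 (S5) if $c\mid a$ and $c\mid b$ then $c\mid a\circ b$ and, when $a\perp b$, $c\mid(a\oplus b)$. A sequential effect algebra (SEA) is an effect algebra with a sequential product. An element $a\in E$ is sharp if $a\wedge a'=0$; $E_S$ is the set of sharp elements. $E$ is sharply dominating if for every $a\in E$ there is a least element $\widehat{a}\in E_S$ with $a\le\widehat{a}$. A sharply dominating SEA $E$ is sequentially ordered if for all $a,b,c\in E$: (1) $a\le b$ implies that there exists $d\in E$ with $a=b\circ d$; and (2) $c\circ a\le c\circ b$ implies $\widehat{c}\circ a\le\widehat{c}\circ b$. In a sequentially ordered SEA, for $a\le b$ there is a unique $c\in E$ with $c\le\widehat{b}$ and $a=b\circ c$; this $c$ is denoted $a/b$. For $b\ne0$ the interval $[0,b]=\{a\in E: 0\le a\le b\}$ is an effect algebra with zero $0$, unit $b$, and $c\oplus_b d=c\oplus d$ defined if and only if $c\oplus d$ is defined in $E$ and $c\oplus d\le b$. If $b$ is sharp, then the restriction of $\circ$ to $[0,b]$ is a sequential product on $[0,b]$. An effect algebra isomorphism $\phi\colon E\to F$ is a surjective map with $\phi(1)=1$ such that $a\perp b$ if and only if $\phi(a)\perp\phi(b)$, and $\phi(a\oplus b)=\phi(a)\oplus\phi(b)$ when $a\perp b$; it is a SEA isomorphism if in addition $\phi(a\circ b)=\phi(a)\circ\phi(b)$ for all $a,b$. *)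

theory Defs
  imports Main "HOL-Library.FuncSet"
begin

text \<open>
  The partial sum is option-valued: \<open>None\<close> means undefined. As usual with carriers, the values of
  operations outside the carrier are irrelevant, and all axioms are relativised to the carrier.
\<close>

record 'a effect_structure =
  carrier :: "'a set"
  zero :: 'a ("\<zero>\<index>")
  one :: 'a ("\<one>\<index>")
  oplus :: "'a \<Rightarrow> 'a \<Rightarrow> 'a option" (infixl "\<oplus>\<index>" 65)

locale effect_algebra =
  fixes E :: "'a effect_structure" (structure)
  assumes zero_closed: "\<zero> \<in> carrier E"
    and one_closed: "\<one> \<in> carrier E"
    and zero_neq_one: "\<zero> \<noteq> \<one>"
    and oplus_closed: "\<And>a b c. \<lbrakk>a \<in> carrier E; b \<in> carrier E; a \<oplus> b = Some c\<rbrakk> \<Longrightarrow> c \<in> carrier E"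
    and A1: "\<And>a b c. \<lbrakk>a \<in> carrier E; b \<in> carrier E; a \<oplus> b = Some c\<rbrakk> \<Longrightarrow> b \<oplus> a = Some c"
    and A2: "\<And>a b c d e. \<lbrakk>a \<in> carrier E; b \<in> carrier E; c \<in> carrier E;
               a \<oplus> b = Some d; d \<oplus> c = Some e\<rbrakk> \<Longrightarrow> \<exists>f. b \<oplus> c = Some f \<and> a \<oplus> f = Some e"
    and A3: "\<And>a. a \<in> carrier E \<Longrightarrow> \<exists>!a'. a' \<in> carrier E \<and> a \<oplus> a' = Some \<one>"
    and A4: "\<And>a. \<lbrakk>a \<in> carrier E; a \<oplus> \<one> \<noteq> None\<rbrakk> \<Longrightarrow> a = \<zero>"

definition orth :: "'a effect_structure \<Rightarrow> 'a \<Rightarrow> 'a \<Rightarrow> bool" where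
  "orth E a b \<longleftrightarrow> a \<oplus>\<^bsub>E\<^esub> b \<noteq> None"

definition ea_le :: "'a effect_structure \<Rightarrow> 'a \<Rightarrow> 'a \<Rightarrow> bool" where
  "ea_le E a b \<longleftrightarrow> (\<exists>c \<in> carrier E. a \<oplus>\<^bsub>E\<^esub> c = Some b)"

definition compl :: "'a effect_structure \<Rightarrow> 'a \<Rightarrow> 'a" where
  "compl E a = (THE a'. a' \<in> carrier E \<and> a \<oplus>\<^bsub>E\<^esub> a' = Some \<one>\<^bsub>E\<^esub>)"

definition is_meet :: "'a effect_structure \<Rightarrow> 'a \<Rightarrow> 'a \<Rightarrow> 'a \<Rightarrow> bool" where
  "is_meet E a b m \<longleftrightarrow> m \<in> carrier E \<and> ea_le E m a \<and> ea_le E m b \<and>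
     (\<forall>x \<in> carrier E. ea_le E x a \<and> ea_le E x b \<longrightarrow> ea_le E x m)"

definition sharp_elements :: "'a effect_structure \<Rightarrow> 'a set" where
  "sharp_elements E = {a \<in> carrier E. is_meet E a (compl E a) \<zero>\<^bsub>E\<^esub>}"

definition is_least_sharp_above :: "'a effect_structure \<Rightarrow> 'a \<Rightarrow> 'a \<Rightarrow> bool" where
  "is_least_sharp_above E a s \<longleftrightarrow> s \<in> sharp_elements E \<and> ea_le E a s \<and>
     (\<forall>t \<in> sharp_elements E. ea_le E a t \<longrightarrow> ea_le E s t)"

definition sharply_dominating :: "'a effect_structure \<Rightarrow> bool" where
  "sharply_dominating E \<longleftrightarrow> (\<forall>a \<in> carrier E. \<exists>s. is_least_sharp_above E a s)"

text \<open>The element written $\widehat{a}$ in the literature.\<close>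

definition sharp_cover :: "'a effect_structure \<Rightarrow> 'a \<Rightarrow> 'a" where
  "sharp_cover E a = (THE s. is_least_sharp_above E a s)"

abbreviation commuting :: "('a \<Rightarrow> 'a \<Rightarrow> 'a) \<Rightarrow> 'a \<Rightarrow> 'a \<Rightarrow> bool" where
  "commuting p a b \<equiv> p a b = p b a"

text \<open>A sequential effect algebra, given by an effect algebra and a sequential product on it.\<close>

locale sequential_effect_algebra = effect_algebra E
  for E :: "'a effect_structure" (structure) +
  fixes sp :: "'a \<Rightarrow> 'a \<Rightarrow> 'a" (infixl "\<circ>\<^sub>s" 70)
  assumes sp_closed: "\<And>a b. \<lbrakk>a \<in> carrier E; b \<in> carrier E\<rbrakk> \<Longrightarrow> a \<circ>\<^sub>s b \<in> carrier E"
    and S1: "\<And>a b c d. \<lbrakk>a \<in> carrier E; b \<in> carrier E; c \<in> carrier E; b \<oplus> c = Some d\<rbrakk>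
               \<Longrightarrow> (a \<circ>\<^sub>s b) \<oplus> (a \<circ>\<^sub>s c) = Some (a \<circ>\<^sub>s d)"
    and S2: "\<And>a. a \<in> carrier E \<Longrightarrow> \<one> \<circ>\<^sub>s a = a"
    and S3: "\<And>a b. \<lbrakk>a \<in> carrier E; b \<in> carrier E; a \<circ>\<^sub>s b = \<zero>\<rbrakk> \<Longrightarrow> commuting (\<circ>\<^sub>s) a b"
    and S4_compl: "\<And>a b. \<lbrakk>a \<in> carrier E; b \<in> carrier E; commuting (\<circ>\<^sub>s) a b\<rbrakk>
               \<Longrightarrow> commuting (\<circ>\<^sub>s) a (compl E b)"
    and S4_assoc: "\<And>a b c. \<lbrakk>a \<in> carrier E; b \<in> carrier E; c \<in> carrier E; commuting (\<circ>\<^sub>s) a b\<rbrakk>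
               \<Longrightarrow> a \<circ>\<^sub>s (b \<circ>\<^sub>s c) = (a \<circ>\<^sub>s b) \<circ>\<^sub>s c"
    and S5_prod: "\<And>a b c. \<lbrakk>a \<in> carrier E; b \<in> carrier E; c \<in> carrier E;
               commuting (\<circ>\<^sub>s) c a; commuting (\<circ>\<^sub>s) c b\<rbrakk> \<Longrightarrow> commuting (\<circ>\<^sub>s) c (a \<circ>\<^sub>s b)"
    and S5_sum: "\<And>a b c d. \<lbrakk>a \<in> carrier E; b \<in> carrier E; c \<in> carrier E;
               commuting (\<circ>\<^sub>s) c a; commuting (\<circ>\<^sub>s) c b; a \<oplus> b = Some d\<rbrakk> \<Longrightarrow> commuting (\<circ>\<^sub>s) c d"

locale sequentially_ordered_sea = sequential_effect_algebra E sp
  for E :: "'a effect_structure" (structure) and sp (infixl "\<circ>\<^sub>s" 70) +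
  assumes sharply_dominating: "sharply_dominating E"
    and le_factor: "\<And>a b. \<lbrakk>a \<in> carrier E; b \<in> carrier E; ea_le E a b\<rbrakk>
               \<Longrightarrow> \<exists>d \<in> carrier E. a = b \<circ>\<^sub>s d"
    and le_cover: "\<And>a b c. \<lbrakk>a \<in> carrier E; b \<in> carrier E; c \<in> carrier E;
               ea_le E (c \<circ>\<^sub>s a) (c \<circ>\<^sub>s b)\<rbrakk>
               \<Longrightarrow> ea_le E (sharp_cover E c \<circ>\<^sub>s a) (sharp_cover E c \<circ>\<^sub>s b)"

text \<open>
  The quotient $a / b$; meaningful for $a \le b$ in a sequentially ordered
  sequential effect algebra, where the described element exists uniquely.
\<close>

definition seq_quot :: "'a effect_structure \<Rightarrow> ('a \<Rightarrow> 'a \<Rightarrow> 'a) \<Rightarrow> 'a \<Rightarrow> 'a \<Rightarrow> 'a" where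
  "seq_quot E sp a b = (THE c. c \<in> carrier E \<and> ea_le E c (sharp_cover E b) \<and> a = sp b c)"

definition interval :: "'a effect_structure \<Rightarrow> 'a \<Rightarrow> 'a effect_structure" where
  "interval E b =
     \<lparr>carrier = {a \<in> carrier E. ea_le E \<zero>\<^bsub>E\<^esub> a \<and> ea_le E a b},
      zero = \<zero>\<^bsub>E\<^esub>,
      one = b,
      oplus = (\<lambda>c d. case c \<oplus>\<^bsub>E\<^esub> d of None \<Rightarrow> None
                       | Some e \<Rightarrow> if ea_le E e b then Some e else None)\<rparr>"

definition ea_iso :: "'a effect_structure \<Rightarrow> 'b effect_structure \<Rightarrow> ('a \<Rightarrow> 'b) \<Rightarrow> bool" where
  "ea_iso E F \<phi> \<longleftrightarrow> effect_algebra E \<and> effect_algebra F \<and>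
     \<phi> ` carrier E = carrier F \<and> \<phi> \<one>\<^bsub>E\<^esub> = \<one>\<^bsub>F\<^esub> \<and>
     (\<forall>a \<in> carrier E. \<forall>b \<in> carrier E. orth E a b \<longleftrightarrow> orth F (\<phi> a) (\<phi> b)) \<and>
     (\<forall>a \<in> carrier E. \<forall>b \<in> carrier E. \<forall>c. a \<oplus>\<^bsub>E\<^esub> b = Some c \<longrightarrow> \<phi> a \<oplus>\<^bsub>F\<^esub> \<phi> b = Some (\<phi> c))"

definition sea_iso :: "'a effect_structure \<Rightarrow> ('a \<Rightarrow> 'a \<Rightarrow> 'a) \<Rightarrow>
    'b effect_structure \<Rightarrow> ('b \<Rightarrow> 'b \<Rightarrow> 'b) \<Rightarrow> ('a \<Rightarrow> 'b) \<Rightarrow> bool" where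
  "sea_iso E p F q \<phi> \<longleftrightarrow> sequential_effect_algebra E p \<and> sequential_effect_algebra F q \<and>
     ea_iso E F \<phi> \<and> (\<forall>a \<in> carrier E. \<forall>b \<in> carrier E. \<phi> (p a b) = q (\<phi> a) (\<phi> b))"

text \<open>
  \<open>p\<close> is a sequential product on the interval $[0,b]$ which is carried to the ambient product
  by $a \mapsto a / b$.
\<close>

definition quot_compatible_product ::
    "'a effect_structure \<Rightarrow> ('a \<Rightarrow> 'a \<Rightarrow> 'a) \<Rightarrow> 'a \<Rightarrow> ('a \<Rightarrow> 'a \<Rightarrow> 'a) \<Rightarrow> bool" where
  "quot_compatible_product E sp b p \<longleftrightarrow>
     sequential_effect_algebra (interval E b) p \<and>
     (\<forall>a \<in> carrier (interval E b). \<forall>c \<in> carrier (interval E b).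
        seq_quot E sp (p a c) b = sp (seq_quot E sp a b) (seq_quot E sp c b))"

end

theory Submission
  imports Defs
begin

text \<open>
  Left multiplication by \<open>b\<close> and the quotient \<open>a \<mapsto> a / b\<close> are mutually inverse order isomorphisms
  between $[0,\widehat{b}]$ and $[0,b]$: condition (1) gives surjectivity, while condition (2) makes
  left multiplication by \<open>b\<close> reflect the order below the sharp element $\widehat{b}$, which acts
  there as an identity. By cancellation they preserve partial sums as well, so the restriction of
  the sequential product to $[0,\widehat{b}]$ can be transported to $[0,b]$.
\<close>

section \<open>Effect algebras\<close>

context effect_algebra
begin

lemma compl_closed: "a \<in> carrier E \<Longrightarrow> compl E a \<in> carrier E"
  and oplus_compl: "a \<in> carrier E \<Longrightarrow> a \<oplus> compl E a = Some \<one>"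
  using theI'[OF A3] unfolding compl_def by blast+

lemma compl_unique:
  "\<lbrakk>a \<in> carrier E; c \<in> carrier E; a \<oplus> c = Some \<one>\<rbrakk> \<Longrightarrow> compl E a = c"
  using A3 compl_closed oplus_compl by blast

text \<open>Commuting the sum of \<open>\<one>\<close> and its complement puts \<open>\<one>\<close>
  on the right, where A4 forces the other summand to be \<open>\<zero>\<close>.\<close>

lemma compl_one: "compl E \<one> = \<zero>"
  using A1 A4 compl_closed one_closed oplus_compl by (metis option.distinct(1))

lemma compl_compl: "a \<in> carrier E \<Longrightarrow> compl E (compl E a) = a"
  using A1 compl_closed compl_unique oplus_compl by blast

lemma compl_zero: "compl E \<zero> = \<one>"
  using compl_compl compl_one one_closed by metis

text \<open>Regrouping (a' + a) + 0 = 1 by A2 makes \<open>a \<oplus> \<zero>\<close> a complement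
  of a', and complements are unique.\<close>

lemma oplus_zero: "a \<in> carrier E \<Longrightarrow> a \<oplus> \<zero> = Some a"
proof -
  assume a: "a \<in> carrier E"
  have 1: "compl E a \<oplus> a = Some \<one>"
    using a A1 compl_closed oplus_compl by blast
  have 2: "\<one> \<oplus> \<zero> = Some \<one>"
    using oplus_compl[OF one_closed] compl_one by simp
  obtain f where f: "a \<oplus> \<zero> = Some f" "compl E a \<oplus> f = Some \<one>"
    using A2[OF compl_closed[OF a] a zero_closed 1 2] by blast
  have "f = a"
    using compl_unique[OF compl_closed[OF a] _ f(2)] compl_compl[OF a]
      oplus_closed[OF a zero_closed f(1)] by simp
  with f show ?thesis by simp
qed

lemma zero_oplus: "a \<in> carrier E \<Longrightarrow> \<zero> \<oplus> a = Some a"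
  using A1 oplus_zero zero_closed by blast

text \<open>Both \<open>b\<close> and \<open>c\<close> turn out to be the complement of the single
  element \<open>a \<oplus> compl E d\<close>.\<close>

lemma oplus_cancel:
  assumes "a \<in> carrier E" "b \<in> carrier E" "c \<in> carrier E"
    and "a \<oplus> b = Some d" "a \<oplus> c = Some d"
  shows "b = c"
proof -
  have d: "d \<in> carrier E"
    using assms oplus_closed by blast
  have *: "\<exists>f. a \<oplus> compl E d = Some f \<and> x \<oplus> f = Some \<one>"
    if "x \<in> carrier E" "a \<oplus> x = Some d" for x
    using A2[OF that(1) assms(1) compl_closed[OF d] A1[OF assms(1) that] oplus_compl[OF d]] .
  obtain f where f: "a \<oplus> compl E d = Some f" "b \<oplus> f = Some \<one>" "c \<oplus> f = Some \<one>"
    using *[OF assms(2,4)] *[OF assms(3,5)] by auto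
  have fc: "f \<in> carrier E"
    using oplus_closed[OF assms(1) compl_closed[OF d] f(1)] .
  show ?thesis
    using compl_unique[OF fc assms(2) A1[OF assms(2) fc f(2)]]
      compl_unique[OF fc assms(3) A1[OF assms(3) fc f(3)]] by simp
qed

text \<open>Adding \<open>\<one>\<close> to x + y = 0 and regrouping shows that y + 1 is defined, so
  A4 applies; commutativity handles the other summand.\<close>

lemma oplus_eq_zero:
  assumes "a \<in> carrier E" "b \<in> carrier E" "a \<oplus> b = Some \<zero>"
  shows "a = \<zero>" "b = \<zero>"
proof -
  have *: "y = \<zero>" if "x \<in> carrier E" "y \<in> carrier E" "x \<oplus> y = Some \<zero>" for x y
    using A2[OF that(1,2) one_closed that(3) zero_oplus[OF one_closed]] A4[OF that(2)] by auto
  show "a = \<zero>" "b = \<zero>"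
    using * assms A1 by blast+
qed

section \<open>The order of an effect algebra\<close>

lemma le_oplus_left: "\<lbrakk>b \<in> carrier E; a \<oplus> b = Some c\<rbrakk> \<Longrightarrow> ea_le E a c"
  unfolding ea_le_def by blast

lemma le_oplus_right: "\<lbrakk>a \<in> carrier E; b \<in> carrier E; a \<oplus> b = Some c\<rbrakk> \<Longrightarrow> ea_le E b c"
  using A1 le_oplus_left by blast

lemma le_refl: "a \<in> carrier E \<Longrightarrow> ea_le E a a"
  using le_oplus_left oplus_zero zero_closed by blast

lemma zero_le: "a \<in> carrier E \<Longrightarrow> ea_le E \<zero> a"
  using le_oplus_left zero_oplus by blast

lemma le_one: "a \<in> carrier E \<Longrightarrow> ea_le E a \<one>"
  using le_oplus_left oplus_compl compl_closed by blast

lemma le_trans: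
  assumes "a \<in> carrier E" "ea_le E a b" "ea_le E b c"
  shows "ea_le E a c"
proof -
  obtain x y where x: "x \<in> carrier E" "a \<oplus> x = Some b" and y: "y \<in> carrier E" "b \<oplus> y = Some c"
    using assms unfolding ea_le_def by blast
  then obtain z where "x \<oplus> y = Some z" "a \<oplus> z = Some c"
    using A2[OF assms(1) x(1) y(1)] by blast
  then show ?thesis
    using x y oplus_closed le_oplus_left by blast
qed

text \<open>The two differences add up to an element that \<open>a\<close> absorbs; cancellation
  makes this sum zero, and then both differences vanish.\<close>

lemma le_antisym:
  assumes "a \<in> carrier E" "ea_le E a b" "ea_le E b a"
  shows "a = b"
proof -
  obtain x y where x: "x \<in> carrier E" "a \<oplus> x = Some b" and y: "y \<in> carrier E" "b \<oplus> y = Some a"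
    using assms unfolding ea_le_def by blast
  obtain z where z: "x \<oplus> y = Some z" "a \<oplus> z = Some a"
    using A2[OF assms(1) x(1) y(1) x(2) y(2)] by blast
  then have "z = \<zero>"
    using oplus_cancel[OF assms(1) _ zero_closed z(2) oplus_zero[OF assms(1)]]
      oplus_closed[OF x(1) y(1) z(1)] by blast
  then have "x = \<zero>"
    using oplus_eq_zero x(1) y(1) z(1) by blast
  then show ?thesis
    using x(2) oplus_zero[OF assms(1)] by simp
qed

lemma le_zero: "\<lbrakk>a \<in> carrier E; ea_le E a \<zero>\<rbrakk> \<Longrightarrow> a = \<zero>"
  using le_antisym zero_le by blast

text \<open>Completing the sum of a' and \<open>c\<close> to \<open>\<one>\<close> by d' exhibits c
  + d' as the complement of a', that is, as \<open>a\<close>. This recovers the order from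
  orthogonality, the relation that \<open>ea_iso\<close> reflects.\<close>

lemma orth_compl_le:
  assumes "a \<in> carrier E" "c \<in> carrier E" "orth E c (compl E a)"
  shows "ea_le E c a"
proof -
  obtain d where d: "c \<oplus> compl E a = Some d"
    using assms(3) unfolding orth_def by blast
  have dc: "d \<in> carrier E"
    using d assms compl_closed oplus_closed by blast
  have "compl E a \<oplus> c = Some d"
    using A1[OF assms(2) compl_closed[OF assms(1)] d] .
  then obtain f where f: "c \<oplus> compl E d = Some f" "compl E a \<oplus> f = Some \<one>"
    using A2[OF compl_closed[OF assms(1)] assms(2) compl_closed[OF dc] _ oplus_compl[OF dc]]
    by blast
  have fc: "f \<in> carrier E"
    using oplus_closed[OF assms(2) compl_closed[OF dc] f(1)] .
  have "f = a"
    using compl_unique[OF compl_closed[OF assms(1)] fc f(2)] compl_compl[OF assms(1)] by simp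
  then show ?thesis
    using f(1) le_oplus_left[OF compl_closed[OF dc]] by simp
qed

section \<open>Intervals as effect algebras\<close>

lemma interval_carrier_iff:
  "a \<in> carrier (interval E b) \<longleftrightarrow> a \<in> carrier E \<and> ea_le E a b"
  using zero_le by (auto simp: interval_def)

lemma interval_zero: "\<zero>\<^bsub>interval E b\<^esub> = \<zero>"
  and interval_one: "\<one>\<^bsub>interval E b\<^esub> = b"
  by (simp_all add: interval_def)

lemma interval_oplus_iff:
  "c \<oplus>\<^bsub>interval E b\<^esub> d = Some e \<longleftrightarrow> c \<oplus> d = Some e \<and> ea_le E e b"
  by (auto simp: interval_def split: option.splits)

lemma interval_effect_algebra:
  assumes b: "b \<in> carrier E" "b \<noteq> \<zero>"
  shows "effect_algebra (interval E b)"
proof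
  show "\<zero>\<^bsub>interval E b\<^esub> \<in> carrier (interval E b)"
    using b zero_closed zero_le by (simp add: interval_carrier_iff interval_zero)
  show "\<one>\<^bsub>interval E b\<^esub> \<in> carrier (interval E b)"
    using b le_refl by (simp add: interval_carrier_iff interval_one)
  show "\<zero>\<^bsub>interval E b\<^esub> \<noteq> \<one>\<^bsub>interval E b\<^esub>"
    using b by (simp add: interval_zero interval_one)
next
  fix a c d
  assume "a \<in> carrier (interval E b)" "c \<in> carrier (interval E b)"
    "a \<oplus>\<^bsub>interval E b\<^esub> c = Some d"
  then show "d \<in> carrier (interval E b)" "c \<oplus>\<^bsub>interval E b\<^esub> a = Some d"
    by (auto simp: interval_carrier_iff interval_oplus_iff intro: oplus_closed A1)
next
  fix x y z d e
  assume "x \<in> carrier (interval E b)" "y \<in> carrier (interval E b)" "z \<in> carrier (interval E b)"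
    "x \<oplus>\<^bsub>interval E b\<^esub> y = Some d" "d \<oplus>\<^bsub>interval E b\<^esub> z = Some e"
  then have x: "x \<in> carrier E" and y: "y \<in> carrier E" and z: "z \<in> carrier E"
    and d: "x \<oplus> y = Some d" and e: "d \<oplus> z = Some e" "ea_le E e b"
    by (auto simp: interval_carrier_iff interval_oplus_iff)
  obtain f where f: "y \<oplus> z = Some f" "x \<oplus> f = Some e"
    using A2[OF x y z d e(1)] by blast
  have fc: "f \<in> carrier E"
    using oplus_closed[OF y z f(1)] .
  \<comment> \<open>The new partial sum stays in the interval because it is a summand of
    \<open>e\<close>.\<close>
  have "ea_le E f b"
    using le_trans[OF fc le_oplus_right[OF x fc f(2)] e(2)] .
  then show "\<exists>f. y \<oplus>\<^bsub>interval E b\<^esub> z = Some f \<and> x \<oplus>\<^bsub>interval E b\<^esub> f = Some e"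
    using f e(2) by (auto simp: interval_oplus_iff)
next
  fix a assume "a \<in> carrier (interval E b)"
  then have a: "a \<in> carrier E" and "ea_le E a b"
    by (auto simp: interval_carrier_iff)
  then obtain c where c: "c \<in> carrier E" "a \<oplus> c = Some b"
    unfolding ea_le_def by blast
  \<comment> \<open>The complement relative to \<open>b\<close> is the difference witnessing
    \<open>a\<close> \<le> \<open>b\<close>; it is unique by cancellation.\<close>
  show "\<exists>!c. c \<in> carrier (interval E b) \<and> a \<oplus>\<^bsub>interval E b\<^esub> c = Some \<one>\<^bsub>interval E b\<^esub>"
  proof (intro ex1I[of _ c])
    show "c \<in> carrier (interval E b) \<and> a \<oplus>\<^bsub>interval E b\<^esub> c = Some \<one>\<^bsub>interval E b\<^esub>"
      using le_refl[OF b(1)] le_oplus_right[OF a c] c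
      by (simp add: interval_carrier_iff interval_oplus_iff interval_one)
  qed (auto simp: interval_carrier_iff interval_oplus_iff interval_one
      intro: oplus_cancel[OF a _ c(1) _ c(2)])
next
  fix a
  assume "a \<in> carrier (interval E b)" and "a \<oplus>\<^bsub>interval E b\<^esub> \<one>\<^bsub>interval E b\<^esub> \<noteq> None"
  then obtain e where a: "a \<in> carrier E" and e: "a \<oplus> b = Some e" "ea_le E e b"
    by (auto simp: interval_carrier_iff interval_oplus_iff interval_one)
  \<comment> \<open>A sum of \<open>a\<close> and \<open>b\<close> that stays below \<open>b\<close>
    must equal \<open>b\<close>, so \<open>a\<close> cancels to zero.\<close>
  have "b = e"
    using le_antisym[OF b(1) le_oplus_right[OF a b(1) e(1)] e(2)] .
  then have "b \<oplus> a = Some b"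
    using A1[OF a b(1) e(1)] by simp
  then show "a = \<zero>\<^bsub>interval E b\<^esub>"
    using oplus_cancel[OF b(1) a zero_closed _ oplus_zero[OF b(1)]] by (simp add: interval_zero)
qed

end

section \<open>Isomorphisms and transport of sequential products\<close>

lemma ea_iso_inj_on:
  assumes "ea_iso E F \<phi>"
  shows "inj_on \<phi> (carrier E)"
proof (rule inj_onI)
  interpret E: effect_algebra E
    using assms by (simp add: ea_iso_def)
  \<comment> \<open>Injectivity comes from reflected orthogonality: \<open>y\<close> is orthogonal
    to its complement, hence so is \<open>x\<close>, which has the same image. By symmetry each of
    \<open>x\<close>, \<open>y\<close> lies below the other.\<close>
  have le: "ea_le E x y"
    if "x \<in> carrier E" "y \<in> carrier E" "\<phi> x = \<phi> y" for x y
  proof -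
    have "orth E y (compl E y)"
      using that E.oplus_compl by (simp add: orth_def)
    then have "orth E x (compl E y)"
      using assms that E.compl_closed unfolding ea_iso_def by metis
    then show ?thesis
      using E.orth_compl_le that by blast
  qed
  show "x = y" if "x \<in> carrier E" "y \<in> carrier E" "\<phi> x = \<phi> y" for x y
    using E.le_antisym le that by metis
qed

lemma ea_iso_zero:
  assumes "ea_iso E F \<phi>"
  shows "\<phi> \<zero>\<^bsub>E\<^esub> = \<zero>\<^bsub>F\<^esub>"
proof -
  interpret E: effect_algebra E
    using assms by (simp add: ea_iso_def)
  interpret F: effect_algebra F
    using assms by (simp add: ea_iso_def)
  have "\<phi> \<zero>\<^bsub>E\<^esub> \<oplus>\<^bsub>F\<^esub> \<one>\<^bsub>F\<^esub> = Some \<one>\<^bsub>F\<^esub>"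
    using assms E.zero_closed E.one_closed E.zero_oplus[OF E.one_closed]
    unfolding ea_iso_def by metis
  then show ?thesis
    using F.A4 assms E.zero_closed unfolding ea_iso_def by blast
qed

lemma ea_iso_compl:
  assumes "ea_iso E F \<phi>" "a \<in> carrier E"
  shows "\<phi> (compl E a) = compl F (\<phi> a)"
proof -
  interpret E: effect_algebra E
    using assms by (simp add: ea_iso_def)
  interpret F: effect_algebra F
    using assms by (simp add: ea_iso_def)
  have "\<phi> a \<oplus>\<^bsub>F\<^esub> \<phi> (compl E a) = Some \<one>\<^bsub>F\<^esub>"
    using assms E.compl_closed E.oplus_compl unfolding ea_iso_def by metis
  moreover have "\<phi> a \<in> carrier F" "\<phi> (compl E a) \<in> carrier F"
    using assms E.compl_closed unfolding ea_iso_def by blast+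
  ultimately show ?thesis
    using F.compl_unique by metis
qed

text \<open>Every axiom for \<open>p\<close> is an equation, a partial sum or an implication between
  commutation relations. An injective map preserving and reflecting sums and carrying
  \<open>p\<close> to \<open>q\<close> lets each be checked in \<open>F\<close>.\<close>

lemma sequential_effect_algebra_transport:
  assumes iso: "ea_iso E F \<phi>" and "sequential_effect_algebra F q"
    and closed: "\<And>a b. \<lbrakk>a \<in> carrier E; b \<in> carrier E\<rbrakk> \<Longrightarrow> p a b \<in> carrier E"
    and hom: "\<And>a b. \<lbrakk>a \<in> carrier E; b \<in> carrier E\<rbrakk> \<Longrightarrow> \<phi> (p a b) = q (\<phi> a) (\<phi> b)"
  shows "sequential_effect_algebra E p"
proof -
  interpret E: effect_algebra E
    using iso by (simp add: ea_iso_def)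
  interpret F: sequential_effect_algebra F q
    by fact
  have inj: "\<phi> a = \<phi> b \<longleftrightarrow> a = b" if "a \<in> carrier E" "b \<in> carrier E" for a b
    using ea_iso_inj_on[OF iso] that by (auto dest: inj_onD)
  have img: "\<phi> a \<in> carrier F" if "a \<in> carrier E" for a
    using iso that unfolding ea_iso_def by blast
  have sum: "\<phi> a \<oplus>\<^bsub>F\<^esub> \<phi> b = Some (\<phi> c)"
    if "a \<in> carrier E" "b \<in> carrier E" "a \<oplus>\<^bsub>E\<^esub> b = Some c" for a b c
    using iso that unfolding ea_iso_def by blast
  \<comment> \<open>\<open>ea_iso\<close> preserves the values of sums only forwards. Backwards,
    reflected orthogonality gives some sum \<open>e\<close>, and injectivity identifies it with
    \<open>c\<close>.\<close>
  have sum': "a \<oplus>\<^bsub>E\<^esub> b = Some c"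
    if abc: "a \<in> carrier E" "b \<in> carrier E" "c \<in> carrier E"
      and "\<phi> a \<oplus>\<^bsub>F\<^esub> \<phi> b = Some (\<phi> c)" for a b c
  proof -
    have "orth E a b"
      using iso that unfolding ea_iso_def orth_def by (metis option.distinct(1))
    then obtain e where e: "a \<oplus>\<^bsub>E\<^esub> b = Some e"
      unfolding orth_def by blast
    then have "\<phi> e = \<phi> c"
      using sum[OF abc(1,2) e] that(4) by simp
    then show ?thesis
      using inj abc e E.oplus_closed by blast
  qed
  have comm: "commuting p a b \<longleftrightarrow> commuting q (\<phi> a) (\<phi> b)"
    if "a \<in> carrier E" "b \<in> carrier E" for a b
    using inj hom closed that by metis
  show ?thesis
  proof
    fix a b c d
    assume abc: "a \<in> carrier E" "b \<in> carrier E" "c \<in> carrier E"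
      and d: "b \<oplus>\<^bsub>E\<^esub> c = Some d"
    have dc: "d \<in> carrier E"
      using E.oplus_closed[OF abc(2,3) d] .
    have "\<phi> (p a b) \<oplus>\<^bsub>F\<^esub> \<phi> (p a c) = Some (\<phi> (p a d))"
      using F.S1[OF img img img sum[OF abc(2,3) d]] abc dc by (simp add: hom)
    then show "p a b \<oplus>\<^bsub>E\<^esub> p a c = Some (p a d)"
      by (intro sum' closed abc dc)
  next
    fix a assume a: "a \<in> carrier E"
    have "\<phi> (p \<one>\<^bsub>E\<^esub> a) = \<phi> a"
      using F.S2[OF img[OF a]] hom[OF E.one_closed a] iso by (simp add: ea_iso_def)
    then show "p \<one>\<^bsub>E\<^esub> a = a"
      using inj[OF closed[OF E.one_closed a] a] by blast
  next
    fix a b assume ab: "a \<in> carrier E" "b \<in> carrier E" and "p a b = \<zero>\<^bsub>E\<^esub>"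
    then have "q (\<phi> a) (\<phi> b) = \<zero>\<^bsub>F\<^esub>"
      using hom[OF ab] ea_iso_zero[OF iso] by simp
    then show "commuting p a b"
      using comm[OF ab] F.S3[OF img img] ab by blast
  next
    fix a b assume ab: "a \<in> carrier E" "b \<in> carrier E" and "commuting p a b"
    then have "commuting q (\<phi> a) (\<phi> (compl E b))"
      using comm[OF ab] F.S4_compl[OF img img] ea_iso_compl[OF iso] by simp
    then show "commuting p a (compl E b)"
      using comm[OF ab(1) E.compl_closed[OF ab(2)]] by blast
  next
    fix a b c
    assume abc: "a \<in> carrier E" "b \<in> carrier E" "c \<in> carrier E" and "commuting p a b"
    then have "q (\<phi> a) (q (\<phi> b) (\<phi> c)) = q (q (\<phi> a) (\<phi> b)) (\<phi> c)"
      using comm[OF abc(1,2)] F.S4_assoc[OF img img img, OF abc] by simp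
    then have "\<phi> (p a (p b c)) = \<phi> (p (p a b) c)"
      using abc by (simp add: hom closed)
    then show "p a (p b c) = p (p a b) c"
      using inj[OF closed[OF abc(1) closed[OF abc(2,3)]] closed[OF closed[OF abc(1,2)] abc(3)]]
      by blast
  next
    fix a b c
    assume abc: "a \<in> carrier E" "b \<in> carrier E" "c \<in> carrier E"
      and "commuting p c a" "commuting p c b"
    then have "commuting q (\<phi> c) (q (\<phi> a) (\<phi> b))"
      using comm[OF abc(3,1)] comm[OF abc(3,2)] F.S5_prod[OF img img img, OF abc] by blast
    then show "commuting p c (p a b)"
      using comm[OF abc(3) closed[OF abc(1,2)]] hom[OF abc(1,2)] by simp
  next
    fix a b c d
    assume abc: "a \<in> carrier E" "b \<in> carrier E" "c \<in> carrier E"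
      and "commuting p c a" "commuting p c b" and d: "a \<oplus>\<^bsub>E\<^esub> b = Some d"
    then have "commuting q (\<phi> c) (\<phi> d)"
      using comm[OF abc(3,1)] comm[OF abc(3,2)]
        F.S5_sum[OF img img img _ _ sum[OF abc(1,2) d], OF abc] by blast
    then show "commuting p c d"
      using comm[OF abc(3) E.oplus_closed[OF abc(1,2) d]] by blast
  qed (fact closed)
qed

section \<open>Sequential products and sharp elements\<close>

context sequential_effect_algebra
begin

text \<open>By S1 the element \<open>a \<circ>\<^sub>s \<zero>\<close> is its own double, so
  cancellation makes it zero.\<close>

lemma sp_zero_right: "a \<in> carrier E \<Longrightarrow> a \<circ>\<^sub>s \<zero> = \<zero>"
  using S1[OF _ zero_closed zero_closed oplus_zero[OF zero_closed]]
    oplus_cancel oplus_zero sp_closed zero_closed by metis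

text \<open>By S3, \<open>a\<close> commutes with \<open>\<zero>\<close>, hence by S4 with its
  complement \<open>\<one>\<close>, and S2 finishes.\<close>

lemma sp_one_right: "a \<in> carrier E \<Longrightarrow> a \<circ>\<^sub>s \<one> = a"
proof -
  assume a: "a \<in> carrier E"
  have "commuting (\<circ>\<^sub>s) a (compl E \<zero>)"
    using S4_compl[OF a zero_closed] S3[OF a zero_closed] sp_zero_right[OF a] by simp
  then show ?thesis
    using S2[OF a] by (simp add: compl_zero)
qed

lemma sp_mono:
  "\<lbrakk>a \<in> carrier E; b \<in> carrier E; ea_le E b c\<rbrakk> \<Longrightarrow> ea_le E (a \<circ>\<^sub>s b) (a \<circ>\<^sub>s c)"
  unfolding ea_le_def using S1 sp_closed by blast

lemma sp_le: "\<lbrakk>a \<in> carrier E; b \<in> carrier E\<rbrakk> \<Longrightarrow> ea_le E (a \<circ>\<^sub>s b) a"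
  using sp_mono[OF _ _ le_one] sp_one_right by metis

section \<open>Sharp elements and their intervals\<close>

lemma sharp_closed: "s \<in> sharp_elements E \<Longrightarrow> s \<in> carrier E"
  by (simp add: sharp_elements_def)

text \<open>Since \<open>s\<close> commutes with itself it commutes with its complement, so their
  product lies below both factors, whose meet is zero.\<close>

lemma sharp_sp_compl:
  assumes "s \<in> sharp_elements E"
  shows "s \<circ>\<^sub>s compl E s = \<zero>" "compl E s \<circ>\<^sub>s s = \<zero>"
proof -
  have s: "s \<in> carrier E" and m: "is_meet E s (compl E s) \<zero>"
    using assms by (auto simp: sharp_elements_def)
  have comm: "commuting (\<circ>\<^sub>s) s (compl E s)"
    using S4_compl[OF s s] by simp
  have "ea_le E (s \<circ>\<^sub>s compl E s) s" "ea_le E (s \<circ>\<^sub>s compl E s) (compl E s)"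
    using sp_le[OF s compl_closed[OF s]] sp_le[OF compl_closed[OF s] s] comm by simp_all
  then have "ea_le E (s \<circ>\<^sub>s compl E s) \<zero>"
    using m sp_closed[OF s compl_closed[OF s]] unfolding is_meet_def by blast
  then show "s \<circ>\<^sub>s compl E s = \<zero>" "compl E s \<circ>\<^sub>s s = \<zero>"
    using le_zero sp_closed[OF s compl_closed[OF s]] comm by simp_all
qed

text \<open>Monotonicity bounds s' times \<open>a\<close> by s' times \<open>s\<close>, which is
  zero. By S3 the product in the other order also vanishes, so splitting \<open>a\<close> along s +
  s' = 1 leaves only \<open>a \<circ>\<^sub>s s\<close>; S4 gives commutation.\<close>

lemma sp_sharp_absorb:
  assumes "s \<in> sharp_elements E" and a: "a \<in> carrier E" "ea_le E a s"
  shows "s \<circ>\<^sub>s a = a" "a \<circ>\<^sub>s s = a"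
proof -
  have s: "s \<in> carrier E"
    using assms sharp_closed by blast
  note s' = compl_closed[OF s]
  have "ea_le E (compl E s \<circ>\<^sub>s a) \<zero>"
    using sp_mono[OF s' a] sharp_sp_compl(2)[OF assms(1)] by simp
  then have 0: "compl E s \<circ>\<^sub>s a = \<zero>"
    using le_zero sp_closed[OF s' a(1)] by blast
  then have 1: "a \<circ>\<^sub>s compl E s = \<zero>"
    using S3[OF s' a(1)] by simp
  then have comm: "commuting (\<circ>\<^sub>s) a s"
    using S4_compl[OF a(1) s'] 0 compl_compl[OF s] by simp
  have "(a \<circ>\<^sub>s s) \<oplus> (a \<circ>\<^sub>s compl E s) = Some a"
    using S1[OF a(1) s s' oplus_compl[OF s]] sp_one_right[OF a(1)] by simp
  then show "a \<circ>\<^sub>s s = a"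
    using 1 oplus_zero[OF sp_closed[OF a(1) s]] by simp
  with comm show "s \<circ>\<^sub>s a = a"
    by simp
qed

text \<open>Products stay in the interval because they lie below their left factor. The axioms that
  see the new unit are S2, given by absorption, and the complement clause of S4, where the
  complement changes.\<close>

lemma sharp_interval_sea:
  assumes sharp: "s \<in> sharp_elements E" and "s \<noteq> \<zero>"
  shows "sequential_effect_algebra (interval E s) (\<circ>\<^sub>s)"
proof -
  have s: "s \<in> carrier E"
    using sharp sharp_closed by blast
  interpret I: effect_algebra "interval E s"
    using interval_effect_algebra[OF s assms(2)] .
  show ?thesis
  proof
    fix a b assume "a \<in> carrier (interval E s)" "b \<in> carrier (interval E s)"
    then show "a \<circ>\<^sub>s b \<in> carrier (interval E s)"
      using sp_closed sp_le le_trans by (metis interval_carrier_iff)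
  next
    fix a b c d
    assume "a \<in> carrier (interval E s)" "b \<in> carrier (interval E s)" "c \<in> carrier (interval E s)"
      "b \<oplus>\<^bsub>interval E s\<^esub> c = Some d"
    then show "(a \<circ>\<^sub>s b) \<oplus>\<^bsub>interval E s\<^esub> (a \<circ>\<^sub>s c) = Some (a \<circ>\<^sub>s d)"
      using S1 sp_closed sp_le le_trans oplus_closed
      by (metis interval_carrier_iff interval_oplus_iff)
  next
    fix a assume "a \<in> carrier (interval E s)"
    then show "\<one>\<^bsub>interval E s\<^esub> \<circ>\<^sub>s a = a"
      using sp_sharp_absorb(1)[OF sharp] by (simp add: interval_carrier_iff interval_one)
  next
    fix a b
    assume "a \<in> carrier (interval E s)" "b \<in> carrier (interval E s)"
      and comm: "commuting (\<circ>\<^sub>s) a b"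
    then have a: "a \<in> carrier E" "ea_le E a s" and b: "b \<in> carrier E" "ea_le E b s"
      by (auto simp: interval_carrier_iff)
    \<comment> \<open>Multiplying b + b' = 1 by \<open>s\<close> identifies the complement of
      \<open>b\<close> within the interval as \<open>s \<circ>\<^sub>s compl E b\<close>.\<close>
    have "b \<oplus> (s \<circ>\<^sub>s compl E b) = Some s"
      using S1[OF s b(1) compl_closed[OF b(1)] oplus_compl[OF b(1)]]
      by (simp add: sp_one_right s sp_sharp_absorb(1)[OF sharp b])
    then have "compl (interval E s) b = s \<circ>\<^sub>s compl E b"
      by (intro I.compl_unique)
        (auto simp: interval_carrier_iff interval_oplus_iff interval_one b s
          sp_closed compl_closed sp_le le_refl)
    \<comment> \<open>By absorption \<open>a\<close> commutes with \<open>s\<close>, and by S4 with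
      b'; S5 gives the product.\<close>
    moreover have "commuting (\<circ>\<^sub>s) a (s \<circ>\<^sub>s compl E b)"
      using S5_prod[OF s compl_closed[OF b(1)] a(1)] sp_sharp_absorb[OF sharp a]
        S4_compl[OF a(1) b(1) comm] by simp
    ultimately show "commuting (\<circ>\<^sub>s) a (compl (interval E s) b)"
      by simp
  next
    fix a b assume "a \<in> carrier (interval E s)" "b \<in> carrier (interval E s)"
      "a \<circ>\<^sub>s b = \<zero>\<^bsub>interval E s\<^esub>"
    then show "commuting (\<circ>\<^sub>s) a b"
      using S3 by (simp add: interval_carrier_iff interval_zero)
  next
    fix a b c
    assume "a \<in> carrier (interval E s)" "b \<in> carrier (interval E s)" "c \<in> carrier (interval E s)"
      "commuting (\<circ>\<^sub>s) a b"
    then show "a \<circ>\<^sub>s (b \<circ>\<^sub>s c) = (a \<circ>\<^sub>s b) \<circ>\<^sub>s c"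
      using S4_assoc by (metis interval_carrier_iff)
  qed (auto simp: interval_carrier_iff interval_oplus_iff intro: S5_prod S5_sum)
qed

end

section \<open>Quotients\<close>

context sequentially_ordered_sea
begin

section \<open>Sharp covers\<close>

lemma sharp_cover_least:
  assumes "b \<in> carrier E"
  shows "is_least_sharp_above E b (sharp_cover E b)"
proof -
  obtain s where s: "is_least_sharp_above E b s"
    using assms sharply_dominating unfolding sharply_dominating_def by blast
  moreover have "t = s" if "is_least_sharp_above E b t" for t
    using s that le_antisym sharp_closed unfolding is_least_sharp_above_def by blast
  ultimately show ?thesis
    unfolding sharp_cover_def by (rule theI)
qed

lemma sharp_cover_sharp: "b \<in> carrier E \<Longrightarrow> sharp_cover E b \<in> sharp_elements E"
  and le_sharp_cover: "b \<in> carrier E \<Longrightarrow> ea_le E b (sharp_cover E b)"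
  using sharp_cover_least unfolding is_least_sharp_above_def by blast+

lemma sharp_cover_closed: "b \<in> carrier E \<Longrightarrow> sharp_cover E b \<in> carrier E"
  using sharp_cover_sharp sharp_closed by blast

lemma sp_sharp_cover: "b \<in> carrier E \<Longrightarrow> b \<circ>\<^sub>s sharp_cover E b = b"
  using sp_sharp_absorb(2) sharp_cover_sharp le_sharp_cover by blast

text \<open>Condition (2) replaces \<open>b\<close> by its sharp cover, which acts as the identity
  on both elements.\<close>

lemma sp_le_cancel:
  assumes b: "b \<in> carrier E"
    and x: "x \<in> carrier (interval E (sharp_cover E b))"
    and y: "y \<in> carrier (interval E (sharp_cover E b))"
    and "ea_le E (b \<circ>\<^sub>s x) (b \<circ>\<^sub>s y)"
  shows "ea_le E x y"
  using le_cover[OF _ _ b assms(4)] x y sp_sharp_absorb(1)[OF sharp_cover_sharp[OF b]]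
  by (simp add: interval_carrier_iff)

text \<open>Two candidates for the quotient have the same product with \<open>b\<close>, so order
  reflection puts each below the other. Thus the definite description is meaningful and dividing
  undoes multiplying.\<close>

lemma seq_quot_sp:
  assumes b: "b \<in> carrier E" and x: "x \<in> carrier (interval E (sharp_cover E b))"
  shows "seq_quot E (\<circ>\<^sub>s) (b \<circ>\<^sub>s x) b = x"
  unfolding seq_quot_def
proof (rule the_equality)
  fix c assume c: "c \<in> carrier E \<and> ea_le E c (sharp_cover E b) \<and> b \<circ>\<^sub>s x = b \<circ>\<^sub>s c"
  then have "c \<in> carrier (interval E (sharp_cover E b))" "b \<circ>\<^sub>s c \<in> carrier E"
    using b sp_closed by (auto simp: interval_carrier_iff)
  then show "c = x"
    using sp_le_cancel[OF b] x c le_refl le_antisym by metis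
qed (use x in \<open>simp add: interval_carrier_iff\<close>)

lemma sp_interval:
  assumes "b \<in> carrier E" "x \<in> carrier (interval E (sharp_cover E b))"
  shows "b \<circ>\<^sub>s x \<in> carrier (interval E b)"
  using assms sp_closed sp_le by (auto simp: interval_carrier_iff)

text \<open>The factor \<open>d\<close> from condition (1) need not lie below the cover of
  \<open>b\<close>. Multiplying it by the cover puts it there without changing the product, because
  \<open>b\<close> commutes with its cover and absorbs it.\<close>

lemma interval_factor:
  assumes b: "b \<in> carrier E" and "a \<in> carrier (interval E b)"
  shows "\<exists>x \<in> carrier (interval E (sharp_cover E b)). a = b \<circ>\<^sub>s x"
proof -
  obtain d where d: "d \<in> carrier E" "a = b \<circ>\<^sub>s d"
    using le_factor[of a b] assms by (auto simp: interval_carrier_iff)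
  note s = sharp_cover_closed[OF b]
  have "b \<circ>\<^sub>s (sharp_cover E b \<circ>\<^sub>s d) = (b \<circ>\<^sub>s sharp_cover E b) \<circ>\<^sub>s d"
    using S4_assoc[OF b s d(1)] sp_sharp_absorb[OF sharp_cover_sharp[OF b] b le_sharp_cover[OF b]]
    by simp
  then have "a = b \<circ>\<^sub>s (sharp_cover E b \<circ>\<^sub>s d)"
    using d sp_sharp_cover[OF b] by simp
  moreover have "sharp_cover E b \<circ>\<^sub>s d \<in> carrier (interval E (sharp_cover E b))"
    using s d sp_closed sp_le by (auto simp: interval_carrier_iff)
  ultimately show ?thesis by blast
qed

lemma seq_quot_interval:
  assumes "b \<in> carrier E" "a \<in> carrier (interval E b)"
  shows "seq_quot E (\<circ>\<^sub>s) a b \<in> carrier (interval E (sharp_cover E b))"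
    and "b \<circ>\<^sub>s seq_quot E (\<circ>\<^sub>s) a b = a"
  using interval_factor[OF assms] seq_quot_sp[OF assms(1)] by auto

lemma seq_quot_oplus_iff:
  assumes b: "b \<in> carrier E"
    and x: "x \<in> carrier (interval E (sharp_cover E b))"
    and y: "y \<in> carrier (interval E (sharp_cover E b))"
    and z: "z \<in> carrier (interval E (sharp_cover E b))"
  shows "x \<oplus>\<^bsub>interval E (sharp_cover E b)\<^esub> y = Some z \<longleftrightarrow>
         (b \<circ>\<^sub>s x) \<oplus>\<^bsub>interval E b\<^esub> (b \<circ>\<^sub>s y) = Some (b \<circ>\<^sub>s z)"
proof
  assume "x \<oplus>\<^bsub>interval E (sharp_cover E b)\<^esub> y = Some z"
  then show "(b \<circ>\<^sub>s x) \<oplus>\<^bsub>interval E b\<^esub> (b \<circ>\<^sub>s y) = Some (b \<circ>\<^sub>s z)"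
    using S1 b x y z sp_le by (simp add: interval_carrier_iff interval_oplus_iff)
next
  assume "(b \<circ>\<^sub>s x) \<oplus>\<^bsub>interval E b\<^esub> (b \<circ>\<^sub>s y) = Some (b \<circ>\<^sub>s z)"
  then have sum: "(b \<circ>\<^sub>s x) \<oplus> (b \<circ>\<^sub>s y) = Some (b \<circ>\<^sub>s z)"
    by (simp add: interval_oplus_iff)
  have xc: "x \<in> carrier E" and yc: "y \<in> carrier E"
    and zc: "z \<in> carrier E" "ea_le E z (sharp_cover E b)"
    using x y z by (auto simp: interval_carrier_iff)
  \<comment> \<open>Order reflection supplies a difference \<open>w\<close> of \<open>z\<close> and
    \<open>x\<close>. Then \<open>w\<close> and \<open>y\<close> have the same product with
    \<open>b\<close> by cancellation, and division by \<open>b\<close> identifies them.\<close>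
  have "ea_le E x z"
    using sp_le_cancel[OF b x z] le_oplus_left[OF sp_closed[OF b yc] sum] by blast
  then obtain w where w: "w \<in> carrier E" "x \<oplus> w = Some z"
    unfolding ea_le_def by blast
  have wi: "w \<in> carrier (interval E (sharp_cover E b))"
    using w le_trans[OF w(1) le_oplus_right[OF xc w] zc(2)] by (simp add: interval_carrier_iff)
  have "b \<circ>\<^sub>s y = b \<circ>\<^sub>s w"
    using oplus_cancel[OF sp_closed[OF b xc] sp_closed[OF b yc] sp_closed[OF b w(1)] sum
        S1[OF b xc w]] .
  then have "y = w"
    using seq_quot_sp[OF b] y wi by metis
  then show "x \<oplus>\<^bsub>interval E (sharp_cover E b)\<^esub> y = Some z"
    using w zc by (simp add: interval_oplus_iff)
qed

lemma sharp_cover_nonzero: "\<lbrakk>b \<in> carrier E; b \<noteq> \<zero>\<rbrakk> \<Longrightarrow> sharp_cover E b \<noteq> \<zero>"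
  using le_sharp_cover le_zero by metis

lemma seq_quot_ea_iso:
  assumes b: "b \<in> carrier E" "b \<noteq> \<zero>"
  shows "ea_iso (interval E b) (interval E (sharp_cover E b)) (\<lambda>a. seq_quot E (\<circ>\<^sub>s) a b)"
proof -
  let ?I = "interval E b" and ?J = "interval E (sharp_cover E b)"
  let ?\<phi> = "\<lambda>a. seq_quot E (\<circ>\<^sub>s) a b"
  interpret I: effect_algebra ?I
    using interval_effect_algebra b .
  interpret J: effect_algebra ?J
    using interval_effect_algebra sharp_cover_closed sharp_cover_nonzero b by blast
  have sum: "a \<oplus>\<^bsub>?I\<^esub> c = Some e \<longleftrightarrow> ?\<phi> a \<oplus>\<^bsub>?J\<^esub> ?\<phi> c = Some (?\<phi> e)"
    if "a \<in> carrier ?I" "c \<in> carrier ?I" "e \<in> carrier ?I" for a c e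
    using seq_quot_oplus_iff[OF b(1) seq_quot_interval(1)[OF b(1) that(1)]
        seq_quot_interval(1)[OF b(1) that(2)] seq_quot_interval(1)[OF b(1) that(3)]]
      seq_quot_interval(2)[OF b(1)] that by simp
  have img: "?\<phi> ` carrier ?I = carrier ?J"
  proof
    show "?\<phi> ` carrier ?I \<subseteq> carrier ?J"
      using seq_quot_interval(1)[OF b(1)] by blast
    show "carrier ?J \<subseteq> ?\<phi> ` carrier ?I"
      using seq_quot_sp[OF b(1)] sp_interval[OF b(1)] by (metis image_eqI subsetI)
  qed
  have one: "?\<phi> \<one>\<^bsub>?I\<^esub> = \<one>\<^bsub>?J\<^esub>"
    using seq_quot_sp[OF b(1) J.one_closed] sp_sharp_cover[OF b(1)] by (simp add: interval_one)
  have orth: "orth ?I a c \<longleftrightarrow> orth ?J (?\<phi> a) (?\<phi> c)"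
    if ac: "a \<in> carrier ?I" "c \<in> carrier ?I" for a c
  proof
    assume "orth ?I a c"
    then obtain e where "a \<oplus>\<^bsub>?I\<^esub> c = Some e"
      unfolding orth_def by blast
    then show "orth ?J (?\<phi> a) (?\<phi> c)"
      using sum ac I.oplus_closed unfolding orth_def by blast
  next
    assume "orth ?J (?\<phi> a) (?\<phi> c)"
    then obtain z where z: "?\<phi> a \<oplus>\<^bsub>?J\<^esub> ?\<phi> c = Some z"
      unfolding orth_def by blast
    \<comment> \<open>Surjectivity writes \<open>z\<close> as a quotient by \<open>b\<close>, which
      is the form that \<open>sum\<close> needs to be read backwards.\<close>
    then have "z \<in> ?\<phi> ` carrier ?I"
      using ac img J.oplus_closed by blast
    then show "orth ?I a c"
      using sum ac z unfolding orth_def by blast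
  qed
  show ?thesis
    unfolding ea_iso_def
    using I.effect_algebra_axioms J.effect_algebra_axioms img one orth sum I.oplus_closed by blast
qed

text \<open>Multiplying the compatibility equation by \<open>b\<close> forces the formula, which
  yields uniqueness on the interval. Conversely, the formula makes the quotient map multiplicative,
  so the sequential product on the interval below the cover can be transported.\<close>

lemma quot_compatible_product_iff:
  assumes b: "b \<in> carrier E" "b \<noteq> \<zero>"
  shows "quot_compatible_product E (\<circ>\<^sub>s) b p \<longleftrightarrow>
    (\<forall>a \<in> carrier (interval E b). \<forall>c \<in> carrier (interval E b).
      p a c = b \<circ>\<^sub>s (seq_quot E (\<circ>\<^sub>s) a b \<circ>\<^sub>s seq_quot E (\<circ>\<^sub>s) c b))" (is "?L \<longleftrightarrow> ?R")
proof
  assume ?L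
  then show ?R
    unfolding quot_compatible_product_def
    using seq_quot_interval(2)[OF b(1)] sequential_effect_algebra.sp_closed by metis
next
  assume p: ?R
  let ?I = "interval E b" and ?J = "interval E (sharp_cover E b)"
  let ?\<phi> = "\<lambda>a. seq_quot E (\<circ>\<^sub>s) a b"
  interpret J: sequential_effect_algebra ?J "(\<circ>\<^sub>s)"
    using sharp_interval_sea sharp_cover_sharp sharp_cover_nonzero b by blast
  have prod: "?\<phi> a \<circ>\<^sub>s ?\<phi> c \<in> carrier ?J"
    if "a \<in> carrier ?I" "c \<in> carrier ?I" for a c
    using J.sp_closed seq_quot_interval(1)[OF b(1)] that by blast
  have hom: "?\<phi> (p a c) = ?\<phi> a \<circ>\<^sub>s ?\<phi> c"
    if "a \<in> carrier ?I" "c \<in> carrier ?I" for a c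
    using p that seq_quot_sp[OF b(1) prod] by simp
  have "sequential_effect_algebra ?I p"
    by (rule sequential_effect_algebra_transport[OF seq_quot_ea_iso[OF b]
          J.sequential_effect_algebra_axioms])
      (use p hom sp_interval[OF b(1) prod] in auto)
  with hom show ?L
    unfolding quot_compatible_product_def by blast
qed

end

theorem theorem5p8:
  fixes E :: "'a effect_structure" and sp :: "'a \<Rightarrow> 'a \<Rightarrow> 'a" and b :: 'a
  assumes "sequentially_ordered_sea E sp"
    and "b \<in> carrier E" and "b \<noteq> \<zero>\<^bsub>E\<^esub>"
  shows "(\<exists>!p. p \<in> carrier (interval E b) \<rightarrow>\<^sub>E carrier (interval E b) \<rightarrow>\<^sub>E carrier (interval E b) \<and>
               quot_compatible_product E sp b p) \<and>
         (\<forall>p. quot_compatible_product E sp b p \<longrightarrow>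
              sea_iso (interval E b) p (interval E (sharp_cover E b)) sp
                (\<lambda>a. seq_quot E sp a b))"
proof (intro conjI allI impI)
  interpret sequentially_ordered_sea E sp
    by fact
  note b = assms(2,3)
  let ?C = "carrier (interval E b)"
  \<comment> \<open>The restricted abstractions fix the values outside the interval, so that
    equality of functions expresses equality of products on it.\<close>
  let ?p = "\<lambda>a\<in>?C. \<lambda>c\<in>?C. sp b (sp (seq_quot E sp a b) (seq_quot E sp c b))"
  have sea: "sequential_effect_algebra (interval E (sharp_cover E b)) sp"
    using sharp_interval_sea sharp_cover_sharp sharp_cover_nonzero b by blast
  have compatible: "quot_compatible_product E sp b ?p"
    by (simp add: quot_compatible_product_iff[OF b])
  show "\<exists>!p. p \<in> ?C \<rightarrow>\<^sub>E ?C \<rightarrow>\<^sub>E ?C \<and> quot_compatible_product E sp b p"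
  proof (intro ex1I[of _ ?p] conjI)
    have "?p a c \<in> ?C" if "a \<in> ?C" "c \<in> ?C" for a c
      using compatible that sequential_effect_algebra.sp_closed
      unfolding quot_compatible_product_def by fast
    then show "?p \<in> ?C \<rightarrow>\<^sub>E ?C \<rightarrow>\<^sub>E ?C"
      by auto
  next
    fix p assume p: "p \<in> ?C \<rightarrow>\<^sub>E ?C \<rightarrow>\<^sub>E ?C \<and> quot_compatible_product E sp b p"
    show "p = ?p"
    proof (intro ext)
      fix a c
      \<comment> \<open>Inside the interval both sides are given by the forced formula; outside,
        extensionality makes both take the default value \<open>undefined\<close>.\<close>
      show "p a c = ?p a c"
        using p quot_compatible_product_iff[OF b]
        by (cases "a \<in> ?C"; cases "c \<in> ?C") (auto simp: PiE_iff extensional_def)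
    qed
  qed (fact compatible)
  show "sea_iso (interval E b) p (interval E (sharp_cover E b)) sp (\<lambda>a. seq_quot E sp a b)"
    if "quot_compatible_product E sp b p" for p
    using that seq_quot_ea_iso[OF b] sea
    unfolding sea_iso_def quot_compatible_product_def by blast
qed

end
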